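(* Let $(S,+,\cdot)$ be a left semibrace. Then the semigroup $(S,+)$ is a rectangular group.
   Context: Multiplication has higher precedence than addition. A left semibrace is a triple $(S,+,\cdot)$ such that $(S,+)$ is a (not necessarily commutative) semigroup, $(S,\cdot)$ is a group, and $x(y+z)=xy+x(x^{-1}+z)$ for all $x,y,z\in S$, where $x^{-1}$ is the inverse of $x$ in $(S,\cdot)$. A rectangular group is a semigroup isomorphic to a semigroup of the following form: the set $I\times G\times\Lambda$, where $(G,+)$ is a (not necessarily abelian) group and $I,\Lambda$ are nonempty sets, with addition $(i,g,\lambda)+(j,h,\mu)=(i,g+h,\mu)$ (that is, the direct product of a left zero semigroup $I$, a group $G$, and a right zero semigroup $\Lambda$). *)

theory Defs
  imports "HOL-Algebra.Group"
begin

definition semigroup_on :: "'a set \<Rightarrow> ('a \<Rightarrow> 'a \<Rightarrow> 'a) \<Rightarrow> bool" where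
  "semigroup_on A p \<longleftrightarrow>
     (\<forall>x\<in>A. \<forall>y\<in>A. p x y \<in> A) \<and>
     (\<forall>x\<in>A. \<forall>y\<in>A. \<forall>z\<in>A. p (p x y) z = p x (p y z))"

definition semigroup_iso ::
  "('a \<Rightarrow> 'b) \<Rightarrow> 'a set \<Rightarrow> ('a \<Rightarrow> 'a \<Rightarrow> 'a) \<Rightarrow> 'b set \<Rightarrow> ('b \<Rightarrow> 'b \<Rightarrow> 'b) \<Rightarrow> bool" where
  "semigroup_iso f A p B q \<longleftrightarrow>
     bij_betw f A B \<and> (\<forall>x\<in>A. \<forall>y\<in>A. f (p x y) = q (f x) (f y))"

(* The multiplicative group of the semibrace is the HOL-Algebra group S;
   the additive operation is the separate parameter. *)
locale left_semibrace = group S for S (structure) +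
  fixes add :: "'a \<Rightarrow> 'a \<Rightarrow> 'a" (infixl "\<boxplus>" 65)
  assumes add_semigroup: "semigroup_on (carrier S) (\<boxplus>)"
    and semibrace_law: "\<lbrakk>x \<in> carrier S; y \<in> carrier S; z \<in> carrier S\<rbrakk>
      \<Longrightarrow> x \<otimes> (y \<boxplus> z) = x \<otimes> y \<boxplus> x \<otimes> (inv x \<boxplus> z)"

(* The group G, customarily additive in this context, uses the multiplicative
   operation of HOL-Algebra; it need not be abelian. *)
fun rect_add :: "('g, 'm) monoid_scheme \<Rightarrow> 'i \<times> 'g \<times> 'l \<Rightarrow> 'i \<times> 'g \<times> 'l \<Rightarrow> 'i \<times> 'g \<times> 'l" where
  "rect_add G (i, g, l) (j, h, m) = (i, g \<otimes>\<^bsub>G\<^esub> h, m)"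

(* HOL cannot quantify existentially over types, so the factors are taken inside the
   element type of A. This is no restriction: each factor embeds in A, and
   rectangular_groupI allows factors over arbitrary types. *)
definition rectangular_group :: "'a set \<Rightarrow> ('a \<Rightarrow> 'a \<Rightarrow> 'a) \<Rightarrow> bool" where
  "rectangular_group A p \<longleftrightarrow> semigroup_on A p \<and>
     (\<exists>(I :: 'a set) (G :: 'a monoid) (L :: 'a set) f.
        I \<noteq> {} \<and> group G \<and> L \<noteq> {} \<and>
        semigroup_iso f A p (I \<times> carrier G \<times> L) (rect_add G))"

lemma rectangular_groupI:
  fixes I :: "'i set" and G :: "('g, 'm) monoid_scheme" and L :: "'l set"
    and A :: "'a set"
  assumes sg: "semigroup_on A p" and I: "I \<noteq> {}" and "group G" and L: "L \<noteq> {}"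
    and iso: "semigroup_iso f A p (I \<times> carrier G \<times> L) (rect_add G)"
  shows "rectangular_group A p"
proof -
  interpret G: group G by fact
  obtain i0 l0 where i0: "i0 \<in> I" and l0: "l0 \<in> L" using I L by blast
  define B where "B = I \<times> carrier G \<times> L"
  define k where "k = inv_into A f"
  have f: "bij_betw f A B" and hom: "\<And>x y. x \<in> A \<Longrightarrow> y \<in> A \<Longrightarrow> f (p x y) = rect_add G (f x) (f y)"
    using iso by (auto simp: semigroup_iso_def B_def)
  have k: "bij_betw k B A" unfolding k_def by (rule bij_betw_inv_into[OF f])
  have kinj: "inj_on k B" using k by (simp add: bij_betw_def)
  define a where "a i = k (i, \<one>\<^bsub>G\<^esub>, l0)" for i
  define b where "b g = k (i0, g, l0)" for g
  define c where "c l = k (i0, \<one>\<^bsub>G\<^esub>, l)" for l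
  have kinjD: "i = i' \<and> g = g' \<and> l = l'"
    if "k (i, g, l) = k (i', g', l')" "i \<in> I" "g \<in> carrier G" "l \<in> L"
      "i' \<in> I" "g' \<in> carrier G" "l' \<in> L" for i g l i' g' l'
    using inj_onD[OF kinj that(1)] that by (simp add: B_def)
  have a: "inj_on a I"
    unfolding a_def by (rule inj_onI, drule kinjD) (use i0 l0 in simp_all)
  have b: "inj_on b (carrier G)"
    unfolding b_def by (rule inj_onI, drule kinjD) (use i0 l0 in simp_all)
  have c: "inj_on c L"
    unfolding c_def by (rule inj_onI, drule kinjD) (use i0 l0 in simp_all)
  define d where "d = inv_into (carrier G) b"
  have db: "d (b g) = g" if "g \<in> carrier G" for g using b that by (simp add: d_def)
  define H where "H = \<lparr>carrier = b ` carrier G, monoid.mult = (\<lambda>x y. b (d x \<otimes>\<^bsub>G\<^esub> d y)), one = b \<one>\<^bsub>G\<^esub>\<rparr>"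
  have "group H"
  proof (rule groupI)
    fix x assume "x \<in> carrier H"
    then obtain g where g: "g \<in> carrier G" "x = b g" by (auto simp: H_def)
    show "\<exists>y\<in>carrier H. y \<otimes>\<^bsub>H\<^esub> x = \<one>\<^bsub>H\<^esub>"
      using g by (intro bexI[of _ "b (inv\<^bsub>G\<^esub> g)"]) (auto simp: H_def db)
  qed (auto simp: H_def db G.m_assoc)
  define m where "m = (\<lambda>(i, g, l). (a i, b g, c l))"
  have m: "bij_betw m B (a ` I \<times> carrier H \<times> c ` L)"
    unfolding bij_betw_def
  proof
    show "inj_on m B" using a b c by (auto simp: m_def B_def intro!: inj_onI dest: inj_onD)
    show "m ` B = a ` I \<times> carrier H \<times> c ` L"
    proof
      show "m ` B \<subseteq> a ` I \<times> carrier H \<times> c ` L" by (auto simp: m_def B_def H_def)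
      show "a ` I \<times> carrier H \<times> c ` L \<subseteq> m ` B"
      proof
        fix z assume "z \<in> a ` I \<times> carrier H \<times> c ` L"
        then obtain i g l where "i \<in> I" "g \<in> carrier G" "l \<in> L" "z = (a i, b g, c l)"
          by (auto simp: H_def)
        then have "z = m (i, g, l)" "(i, g, l) \<in> B" by (simp_all add: m_def B_def)
        then show "z \<in> m ` B" by blast
      qed
    qed
  qed
  have mh: "m (rect_add G u v) = rect_add H (m u) (m v)" if "u \<in> B" "v \<in> B" for u v
    using that by (cases u; cases v) (auto simp: m_def B_def H_def db)
  have "semigroup_iso (m \<circ> f) A p (a ` I \<times> carrier H \<times> c ` L) (rect_add H)"
    unfolding semigroup_iso_def
  proof (intro conjI ballI)
    show "bij_betw (m \<circ> f) A (a ` I \<times> carrier H \<times> c ` L)" by (rule bij_betw_trans[OF f m])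
    fix x y assume "x \<in> A" "y \<in> A"
    then show "(m \<circ> f) (p x y) = rect_add H ((m \<circ> f) x) ((m \<circ> f) y)"
      using hom mh bij_betwE[OF f] by simp
  qed
  moreover have "a ` I \<noteq> {}" "c ` L \<noteq> {}" using I L by simp_all
  ultimately show ?thesis unfolding rectangular_group_def
    using sg \<open>group H\<close> by (intro conjI exI) assumption+
qed

end

theory Submission
  imports Defs
begin

text \<open>
  Put \<open>\<lambda>\<^sub>x z = x (x\<^sup>-\<^sup>1 + z)\<close>. The semibrace law becomes \<open>x (y + z) = x y + \<lambda>\<^sub>x z\<close>; it makes
  \<open>x \<mapsto> \<lambda>\<^sub>x\<close> an action of the multiplicative group by additive endomorphisms, except that the
  identity \<open>1\<close> acts as \<open>\<lambda>\<^sub>1 z = 1 + z\<close>. For \<open>x = 1\<close> the law says that \<open>1\<close> is a middle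
  unit: \<open>y + 1 + z = y + z\<close>. All \<open>\<lambda>\<^sub>x\<close> are therefore automorphisms of the right ideal
  \<open>T = 1 + S\<close>, and addition is recovered by \<open>x + z = x \<lambda>\<^sub>x\<^sup>-\<^sup>1(1 + z)\<close>, so that it is left
  cancellative up to \<open>z \<mapsto> 1 + z\<close> (\<open>add_left_cancel\<close>).

  Three consequences follow. First, \<open>1 + 1 = 1\<close>. Second, any additive idempotent acts from the left
  on \<open>T\<close> as the identity. Third, each \<open>t\<close> in \<open>T\<close> has an additive right inverse:
  for \<open>r = t\<^sup>-\<^sup>1\<close> one finds \<open>r + \<lambda>\<^sub>r t = 1\<close>, hence by cancellation \<open>\<lambda>\<^sub>r t\<close> is right
  invertible, and the automorphism \<open>\<lambda>\<^sub>t\<close> moves this property from \<open>\<lambda>\<^sub>r t\<close> to \<open>t\<close>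
  (\<open>right_inverse_exists\<close>). So \<open>T\<close> is a right group, and since \<open>x \<in> x + S\<close> for every \<open>x\<close>,
  the semigroup \<open>(S,+)\<close> is regular.

  What remains is a fact about semigroups (\<open>rectangular_group_of_middle_unit\<close>): if a regular
  semigroup has an idempotent middle unit \<open>e\<close> and \<open>e + S + e\<close> is a group, then \<open>x\<close> is
  determined by \<open>g = e + x + e\<close> together with \<open>x + g'\<close> and \<open>g' + x\<close>, where \<open>g'\<close> is the
  inverse of \<open>g\<close> in that group, and these three coordinates identify \<open>S\<close> with a rectangular group.
\<close>

section \<open>Regular semigroups with an idempotent middle unit\<close>

text \<open>
  Because \<open>e\<close> is a middle unit, \<open>x \<mapsto> e x e\<close> is a homomorphism onto the local submonoid at
  \<open>e\<close>. The last hypothesis supplies inverses there; uniqueness of inverses in a group then lets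
  one replace the given \<open>y\<close> by the inverse \<open>h\<close> of \<open>e x e\<close>, so that \<open>x h x = x\<close>. The
  coordinates of \<open>x\<close> are \<open>x h\<close>, \<open>e x e\<close> and \<open>h x\<close>.
\<close>

lemma rectangular_group_of_middle_unit:
  fixes A :: "'a set" and p :: "'a \<Rightarrow> 'a \<Rightarrow> 'a"
  assumes sg: "semigroup_on A p"
    and e: "e \<in> A" and idem: "p e e = e"
    and middle: "\<And>x y. x \<in> A \<Longrightarrow> y \<in> A \<Longrightarrow> p x (p e y) = p x y"
    and inverse: "\<And>x. x \<in> A \<Longrightarrow> \<exists>y\<in>A. p (p x y) x = x \<and> p (p e (p y x)) e = e"
  shows "rectangular_group A p"
proof -
  have cl [simp]: "p x y \<in> A" if "x \<in> A" "y \<in> A" for x y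
    using sg that by (auto simp: semigroup_on_def)
  have assoc [simp]: "p (p x y) z = p x (p y z)" if "x \<in> A" "y \<in> A" "z \<in> A" for x y z
    using sg that by (auto simp: semigroup_on_def)
  note [simp] = e idem middle
  define loc where "loc x = p e (p x e)" for x
  define G where "G = \<lparr>carrier = loc ` A, monoid.mult = p, one = e\<rparr>"
  have loc_hom: "loc (p x y) = p (loc x) (loc y)" if "x \<in> A" "y \<in> A" for x y
    using that by (simp add: loc_def)
  have loc_in: "loc x \<in> carrier G" if "x \<in> A" for x using that by (simp add: G_def)
  have GA: "g \<in> A" "p e g = g" "p g e = g" if "g \<in> carrier G" for g
    using that by (auto simp: G_def loc_def)
  have G_mult: "g \<otimes>\<^bsub>G\<^esub> h = p g h" and G_one: "\<one>\<^bsub>G\<^esub> = e" for g h by (simp_all add: G_def)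
  have "group G"
  proof (rule groupI)
    fix g assume g: "g \<in> carrier G"
    then obtain y where y: "y \<in> A" "p (p e (p y g)) e = e" using inverse GA by blast
    have "p (loc y) g = e" using y g GA[OF g] by (simp add: loc_def)
    then show "\<exists>h\<in>carrier G. h \<otimes>\<^bsub>G\<^esub> g = \<one>\<^bsub>G\<^esub>"
      using loc_in y by (auto simp: G_mult G_one)
  next
    fix g h assume gh: "g \<in> carrier G" "h \<in> carrier G"
    have "loc (p g h) = p (p e g) (p h e)"
      using GA(1)[OF gh(1)] GA(1)[OF gh(2)] by (simp add: loc_def)
    also have "\<dots> = p g h" using GA gh by simp
    finally have "loc (p g h) = p g h" .
    then show "g \<otimes>\<^bsub>G\<^esub> h \<in> carrier G" using loc_in GA gh by (metis G_mult cl)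
  next
    show "\<one>\<^bsub>G\<^esub> \<in> carrier G" using loc_in[OF e] by (simp add: G_one loc_def)
  qed (auto simp: G_mult G_one GA)
  then interpret G: group G .
  define n where "n g = inv\<^bsub>G\<^esub> g" for g
  have n: "n g \<in> carrier G" "p (n g) g = e" "p g (n g) = e" if "g \<in> carrier G" for g
    using that G.l_inv G.r_inv by (simp_all add: n_def G_mult G_one)
  have n_mult: "n (p g h) = p (n h) (n g)" if "g \<in> carrier G" "h \<in> carrier G" for g h
    using G.inv_mult_group[OF that] by (simp add: n_def G_mult)
  define h where "h x = n (loc x)" for x
  have hG: "h x \<in> carrier G" if "x \<in> A" for x using that n loc_in by (simp add: h_def)
  note hA [simp] = GA[OF hG]
  have hA' [simp]: "p (h x) (p e z) = p (h x) z" if "x \<in> A" "z \<in> A" for x z using that by simp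
  \<comment> \<open>Next to an element of the local group, \<open>x\<close> may be replaced by \<open>e x e\<close>.\<close>
  have inv_l: "p (h x) (p x g) = g" if "x \<in> A" "g \<in> carrier G" for x g
  proof -
    have "p (h x) (p x g) = p (p (h x) (loc x)) g" using that GA[OF that(2)] by (simp add: loc_def)
    then show ?thesis using that n loc_in GA by (simp add: h_def)
  qed
  have inv_r: "p g (p x (h x)) = g" if "x \<in> A" "g \<in> carrier G" for x g
  proof -
    have "p g (p x (h x)) = p g (p (loc x) (h x))" using that GA[OF that(2)] by (simp add: loc_def)
    then show ?thesis using that n loc_in GA by (simp add: h_def)
  qed
  have reg: "p x (p (h x) x) = x" if x: "x \<in> A" for x
  proof -
    obtain y where y: "y \<in> A" "p (p x y) x = x" "p (p e (p y x)) e = e"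
      using inverse[OF x] by blast
    have "p (loc y) (loc x) = e" using x y by (simp add: loc_def)
    then have "h x = loc y" using G.inv_equality x y loc_in by (simp add: h_def n_def G_mult G_one)
    then show ?thesis using x y by (simp add: loc_def)
  qed
  define a where "a x = p x (h x)" for x
  define b where "b x = p (h x) x" for x
  have ab [simp]: "a x \<in> A" "b x \<in> A" if "x \<in> A" for x using that by (simp_all add: a_def b_def)
  define f where "f x = (a x, loc x, b x)" for x
  have recover: "x = p (a x) (p (loc x) (b x))" if "x \<in> A" for x
    using that reg by (simp add: a_def b_def loc_def)
  have h_hom: "h (p x y) = p (h y) (h x)" if "x \<in> A" "y \<in> A" for x y
    using that by (simp add: h_def loc_hom n_mult loc_in)
  have a_hom: "a (p x y) = a x" if "x \<in> A" "y \<in> A" for x y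
  proof -
    have "a (p x y) = p x (p (p e (p y (h y))) (h x))" using that by (simp add: a_def h_hom)
    also have "p e (p y (h y)) = e" using inv_r[OF that(2), of e] G.one_closed by (simp add: G_one)
    finally show ?thesis using that by (simp add: a_def)
  qed
  have b_hom: "b (p x y) = b y" if "x \<in> A" "y \<in> A" for x y
  proof -
    have "b (p x y) = p (h y) (p (p (h x) (p x e)) y)" using that by (simp add: b_def h_hom)
    also have "p (h x) (p x e) = e" using inv_l[OF that(1), of e] G.one_closed by (simp add: G_one)
    finally show ?thesis using that by (simp add: b_def)
  qed
  have "semigroup_iso f A p (a ` A \<times> carrier G \<times> b ` A) (rect_add G)"
    unfolding semigroup_iso_def bij_betw_def
  proof (intro conjI ballI)
    show "inj_on f A"
      by (rule inj_onI, subst recover, assumption) (use recover in \<open>simp add: f_def\<close>)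
    show "f ` A = a ` A \<times> carrier G \<times> b ` A"
    proof
      show "f ` A \<subseteq> a ` A \<times> carrier G \<times> b ` A" by (auto simp: f_def loc_in)
      show "a ` A \<times> carrier G \<times> b ` A \<subseteq> f ` A"
      proof clarify
        fix x g y assume x: "x \<in> A" and g: "g \<in> carrier G" and y: "y \<in> A"
        define w where "w = p (a x) (p g (b y))"
        have w: "w \<in> A" using x y GA[OF g] by (simp add: w_def)
        have "a w = a (p x (p (h x) (p g (b y))))" "b w = b (p (p (p (a x) g) (h y)) y)"
          using x y GA[OF g] by (simp_all add: w_def a_def b_def)
        then have "a w = a x" "b w = b y" using x y GA[OF g] by (simp_all add: a_hom b_hom del: assoc)
        moreover have "loc w = g"
        proof -
          have ex: "p e (a x) = e" using inv_r[OF x, of e] G.one_closed by (simp add: G_one a_def)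
          have ye: "p (b y) e = e" using inv_l[OF y, of e] G.one_closed y by (simp add: G_one b_def)
          have "loc w = p (p e (a x)) (p g (p (b y) e))"
            using x y GA[OF g] by (simp add: w_def loc_def)
          then show ?thesis using GA[OF g] by (simp only: ex ye)
        qed
        ultimately have "f w = (a x, g, b y)" by (simp add: f_def)
        then show "(a x, g, b y) \<in> f ` A" using w by (metis image_eqI)
      qed
    qed
    fix x y assume "x \<in> A" "y \<in> A"
    then show "f (p x y) = rect_add G (f x) (f y)"
      by (simp add: f_def a_hom b_hom loc_hom G_mult)
  qed
  moreover have "a ` A \<noteq> {}" "b ` A \<noteq> {}" using e by (simp_all only: image_is_empty) blast+
  ultimately show ?thesis by (intro rectangular_groupI[OF sg _ \<open>group G\<close>])
qed

section \<open>The additive semigroup of a left semibrace\<close>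

context left_semibrace
begin

lemma add_closed [simp]: "x \<in> carrier S \<Longrightarrow> y \<in> carrier S \<Longrightarrow> x \<boxplus> y \<in> carrier S"
  using add_semigroup by (simp add: semigroup_on_def)

lemma add_assoc [simp]:
  "x \<in> carrier S \<Longrightarrow> y \<in> carrier S \<Longrightarrow> z \<in> carrier S \<Longrightarrow> (x \<boxplus> y) \<boxplus> z = x \<boxplus> (y \<boxplus> z)"
  using add_semigroup by (simp add: semigroup_on_def)

definition lam :: "'a \<Rightarrow> 'a \<Rightarrow> 'a" where
  "lam x z = x \<otimes> (inv x \<boxplus> z)"

lemma lam_closed [simp]: "x \<in> carrier S \<Longrightarrow> z \<in> carrier S \<Longrightarrow> lam x z \<in> carrier S"
  by (simp add: lam_def)

lemma mult_add:
  "x \<in> carrier S \<Longrightarrow> y \<in> carrier S \<Longrightarrow> z \<in> carrier S \<Longrightarrow> x \<otimes> (y \<boxplus> z) = x \<otimes> y \<boxplus> lam x z"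
  unfolding lam_def by (rule semibrace_law)

lemma one_middle_unit [simp]:
  "y \<in> carrier S \<Longrightarrow> z \<in> carrier S \<Longrightarrow> y \<boxplus> (\<one> \<boxplus> z) = y \<boxplus> z"
  using semibrace_law[of \<one> y z] by simp

lemma lam_one: "z \<in> carrier S \<Longrightarrow> lam \<one> z = \<one> \<boxplus> z"
  by (simp add: lam_def)

lemma lam_mult:
  assumes "x \<in> carrier S" "y \<in> carrier S" "z \<in> carrier S"
  shows "lam (x \<otimes> y) z = lam x (lam y z)"
proof -
  have "lam (x \<otimes> y) z = x \<otimes> (y \<otimes> (inv y \<otimes> inv x \<boxplus> z))"
    using assms by (simp add: lam_def inv_mult_group m_assoc)
  also have "y \<otimes> (inv y \<otimes> inv x \<boxplus> z) = inv x \<boxplus> lam y z"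
    using assms by (simp add: mult_add flip: m_assoc)
  finally show ?thesis by (simp add: lam_def)
qed

lemma lam_add:
  assumes "x \<in> carrier S" "y \<in> carrier S" "z \<in> carrier S"
  shows "lam x (y \<boxplus> z) = lam x y \<boxplus> lam x z"
  using assms mult_add[of x "inv x \<boxplus> y" z] by (simp add: lam_def)

lemma one_add_lam [simp]:
  assumes "x \<in> carrier S" "z \<in> carrier S"
  shows "\<one> \<boxplus> lam x z = lam x z"
  using assms lam_mult[of \<one> x z] by (simp add: lam_one)

lemma lam_lam_inv: "x \<in> carrier S \<Longrightarrow> z \<in> carrier S \<Longrightarrow> lam x (lam (inv x) z) = \<one> \<boxplus> z"
  by (simp add: lam_one flip: lam_mult)

lemma add_conv_mult: "x \<in> carrier S \<Longrightarrow> z \<in> carrier S \<Longrightarrow> x \<boxplus> z = x \<otimes> lam (inv x) z"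
  by (simp add: lam_def flip: m_assoc)

lemma add_lam:
  assumes "x \<in> carrier S" "z \<in> carrier S"
  shows "x \<boxplus> lam x z = x \<otimes> (\<one> \<boxplus> z)"
  using assms lam_lam_inv[of "inv x" z] by (simp add: add_conv_mult[of x "lam x z"])

text \<open>
  The sum \<open>x + y\<close> equals \<open>x\<close> times the image of \<open>y\<close> under \<open>lam (inv x)\<close>, and applying
  \<open>lam x\<close> to that image returns \<open>1 + y\<close>.
\<close>

lemma add_left_cancel:
  assumes "x \<in> carrier S" "y \<in> carrier S" "z \<in> carrier S" and eq: "x \<boxplus> y = x \<boxplus> z"
  shows "\<one> \<boxplus> y = \<one> \<boxplus> z"
proof -
  have "lam (inv x) y = lam (inv x) z"
    using assms by (simp add: add_conv_mult)
  then show ?thesis using assms(1-3) lam_lam_inv by metis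
qed

text \<open>
  The element \<open>e = 1 + 1\<close> satisfies \<open>e = e + e\<close>, which is \<open>e\<close> times an element of \<open>1 + S\<close>;
  this factor can only be \<open>1\<close>. Thus \<open>1\<close> lies in \<open>1 + S\<close>, where \<open>1\<close> is a left unit.
\<close>

lemma one_add_one [simp]: "\<one> \<boxplus> \<one> = \<one>"
proof -
  define e where "e = \<one> \<boxplus> \<one>"
  have e: "e \<in> carrier S" by (simp add: e_def)
  have "e \<boxplus> e = e" by (simp add: e_def)
  then have "e \<otimes> lam (inv e) e = e \<otimes> \<one>" using e by (simp flip: add_conv_mult)
  then have "lam (inv e) e = \<one>" using e by simp
  then show ?thesis using one_add_lam[of "inv e" e] e by simp
qed

lemma add_lam_one [simp]: "x \<in> carrier S \<Longrightarrow> x \<boxplus> lam x \<one> = x"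
  by (simp add: add_lam)

lemma idempotent_left_unit:
  assumes "f \<in> carrier S" "z \<in> carrier S" and idem: "f \<boxplus> f = f"
  shows "\<one> \<boxplus> (f \<boxplus> z) = \<one> \<boxplus> z"
proof (rule add_left_cancel)
  show "f \<boxplus> (f \<boxplus> z) = f \<boxplus> z" using assms by (simp flip: add_assoc)
qed (use assms in simp_all)

text \<open>
  With \<open>s\<close> the image of \<open>t\<close> under \<open>lam (inv t)\<close>, the sum \<open>inv t + s\<close> is \<open>1\<close>, so \<open>s\<close> has
  the left inverse \<open>inv t\<close>; left cancellation turns this into a right inverse. Applying
  \<open>lam t\<close> sends \<open>s\<close> back to \<open>t\<close>, and sends \<open>1\<close> to an idempotent, which adding \<open>1\<close> on the
  right sends to \<open>1\<close>.
\<close>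

lemma right_inverse_exists:
  assumes t: "t \<in> carrier S" and T: "\<one> \<boxplus> t = t"
  shows "\<exists>y\<in>carrier S. t \<boxplus> y = \<one>"
proof -
  define r where "r = inv t"
  define s where "s = lam r t"
  define q where "q = \<one> \<boxplus> r"
  have r: "r \<in> carrier S" using t by (simp add: r_def)
  then have q: "q \<in> carrier S" by (simp add: q_def)
  have s: "s \<in> carrier S" "\<one> \<boxplus> s = s" using r t by (simp_all add: s_def)
  have "r \<boxplus> s = \<one>" using r t T by (simp add: s_def add_lam) (simp add: r_def)
  then have qs: "q \<boxplus> s = \<one>" using r s(1) by (simp add: q_def)
  have "\<one> \<boxplus> (s \<boxplus> (r \<boxplus> \<one>)) = \<one> \<boxplus> \<one>"
  proof (rule add_left_cancel[of q])
    have "q \<boxplus> (s \<boxplus> (r \<boxplus> \<one>)) = (q \<boxplus> s) \<boxplus> (r \<boxplus> \<one>)" using r q s(1) by simp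
    also have "\<dots> = \<one> \<boxplus> (r \<boxplus> \<one>)" by (simp only: qs)
    also have "\<dots> = q \<boxplus> \<one>" using r by (simp add: q_def)
    finally show "q \<boxplus> (s \<boxplus> (r \<boxplus> \<one>)) = q \<boxplus> \<one>" .
  qed (use r q s in simp_all)
  then have "s \<boxplus> (r \<boxplus> \<one>) = \<one>" using r s by (simp flip: add_assoc)
  then have "lam t s \<boxplus> lam t (r \<boxplus> \<one>) = lam t \<one>" using r s t by (simp flip: lam_add)
  moreover have "lam t s = t" using t T by (simp add: s_def r_def lam_lam_inv)
  moreover have "lam t \<one> \<boxplus> \<one> = \<one>"
    using idempotent_left_unit[of "lam t \<one>" \<one>] t
    by (simp flip: add_assoc lam_add)
  ultimately have "t \<boxplus> (lam t (r \<boxplus> \<one>) \<boxplus> \<one>) = \<one>" using r t by (simp flip: add_assoc)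
  then show ?thesis using r t
    by (intro bexI[of _ "lam t (r \<boxplus> \<one>) \<boxplus> \<one>"]) simp_all
qed

text \<open>
  For a right inverse \<open>y\<close> of \<open>1 + x\<close>, the sum \<open>y + x\<close> is idempotent and hence a left unit
  on \<open>1 + S\<close>. Regularity results because \<open>x\<close> can be written as \<open>x + z\<close> with \<open>z\<close> in \<open>1 + S\<close>.
\<close>

lemma regular_and_locally_invertible:
  assumes x: "x \<in> carrier S"
  shows "\<exists>y\<in>carrier S. (x \<boxplus> y) \<boxplus> x = x \<and> (\<one> \<boxplus> (y \<boxplus> x)) \<boxplus> \<one> = \<one>"
proof -
  obtain y where y: "y \<in> carrier S" and xy: "\<one> \<boxplus> (x \<boxplus> y) = \<one>"
    using right_inverse_exists[of "\<one> \<boxplus> x"] x by auto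
  have "(y \<boxplus> x) \<boxplus> (y \<boxplus> x) = y \<boxplus> ((\<one> \<boxplus> (x \<boxplus> y)) \<boxplus> x)" using x y by simp
  also have "\<dots> = y \<boxplus> x" using x y by (simp only: xy one_middle_unit)
  finally have idem: "(y \<boxplus> x) \<boxplus> (y \<boxplus> x) = y \<boxplus> x" .
  define z where "z = lam x \<one>"
  have z: "z \<in> carrier S" "x \<boxplus> z = x" using x by (simp_all add: z_def)
  have unit: "\<one> \<boxplus> ((y \<boxplus> x) \<boxplus> w) = \<one> \<boxplus> w" if "w \<in> carrier S" for w
    using x y by (intro idempotent_left_unit[OF _ that idem]) simp
  have "(x \<boxplus> y) \<boxplus> x = (x \<boxplus> y) \<boxplus> (x \<boxplus> z)" by (simp only: z)
  also have "\<dots> = x \<boxplus> (\<one> \<boxplus> ((y \<boxplus> x) \<boxplus> z))" using x y z(1) by simp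
  also have "\<dots> = x" using x z by (simp only: unit one_middle_unit)
  finally show ?thesis using unit[of \<one>] x y by auto
qed

end

theorem theorem2p4:
  fixes S :: "('a, 'b) monoid_scheme" and add :: "'a \<Rightarrow> 'a \<Rightarrow> 'a"
  assumes "left_semibrace S add"
  shows "rectangular_group (carrier S) add"
proof -
  interpret left_semibrace S add by fact
  show ?thesis
    by (rule rectangular_group_of_middle_unit[OF add_semigroup one_closed])
      (use regular_and_locally_invertible in simp_all)
qed

end
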